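(* For every natural number $k > 2$ there exists a bidiophantine rectangle one of whose sides has length $k$.
   Context: Natural numbers are the positive integers. A polygon in the Euclidean plane $\mathbb{R}^2$ is called Diophantine if the distance between every two of its vertices is a natural number. A Diophantine polygon is called bidiophantine if both coordinates of each of its vertices are integers. *)

theory Defs
  imports "HOL-Analysis.Analysis"
begin

text \<open>
  A polygon is given by the list of its vertices in cyclic order; side \<open>i\<close> joins vertex \<open>i\<close>
  to its cyclic successor.
\<close>

definition nxt :: "'a list \<Rightarrow> nat \<Rightarrow> nat" where
  "nxt P i = Suc i mod length P"

definition side_ends :: "(real^2) list \<Rightarrow> nat \<Rightarrow> (real^2) set" where
  "side_ends P i = {P ! i, P ! nxt P i}"

definition side :: "(real^2) list \<Rightarrow> nat \<Rightarrow> (real^2) set" where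
  "side P i = closed_segment (P ! i) (P ! nxt P i)"

definition side_length :: "(real^2) list \<Rightarrow> nat \<Rightarrow> real" where
  "side_length P i = dist (P ! i) (P ! nxt P i)"

text \<open>
  The polygon is simple: distinct sides meet only in a common end point, so adjacent sides share
  exactly one vertex and non-adjacent sides are disjoint. No vertex has a straight angle.
\<close>

definition polygon :: "(real^2) list \<Rightarrow> bool" where
  "polygon P \<longleftrightarrow>
     3 \<le> length P \<and> distinct P \<and>
     (\<forall>i < length P. \<forall>j < length P. i \<noteq> j \<longrightarrow>
        side P i \<inter> side P j = side_ends P i \<inter> side_ends P j) \<and>
     (\<forall>i < length P. \<not> collinear {P ! i, P ! nxt P i, P ! nxt P (nxt P i)})"

definition rectangle :: "(real^2) list \<Rightarrow> bool" where
  "rectangle P \<longleftrightarrow>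
     polygon P \<and> length P = 4 \<and>
     (\<forall>i < length P. orthogonal (P ! i - P ! nxt P i) (P ! nxt P (nxt P i) - P ! nxt P i))"

definition diophantine :: "(real^2) list \<Rightarrow> bool" where
  "diophantine P \<longleftrightarrow>
     polygon P \<and>
     (\<forall>A \<in> set P. \<forall>B \<in> set P. A \<noteq> B \<longrightarrow> (\<exists>n::nat. 0 < n \<and> dist A B = real n))"

definition bidiophantine :: "(real^2) list \<Rightarrow> bool" where
  "bidiophantine P \<longleftrightarrow> diophantine P \<and> (\<forall>A \<in> set P. \<forall>c. A $ c \<in> \<int>)"

end

(* An axis-parallel rectangle with vertices at lattice points is bidiophantine as soon as its
   sides k, m are the legs of a Pythagorean triple.  Every k > 2 is a leg: of
   (2 j + 1, 2 j (j + 1), 2 j (j + 1) + 1) if k = 2 j + 1, and of (2 j, j^2 - 1, j^2 + 1) if k = 2 j. *)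
theory Submission
  imports Defs
begin

lemma pythagorean_leg_exists:
  fixes k :: nat
  assumes "k > 2"
  obtains m h :: nat where "m > 0" "k\<^sup>2 + m\<^sup>2 = h\<^sup>2"
proof (cases "even k")
  case True
  then obtain j where k: "k = 2 * j" by blast
  \<comment> \<open>Since \<open>k > 2\<close> forces \<open>j\<close> \<ge> 2, this truncated
    subtraction is exact. The shift turns j^2 - 1 into \<open>(i + 1) * (i + 3)\<close>, a visibly
    positive product free of natural subtraction.\<close>
  define i where "i = j - 2"
  have "j = i + 2" using assms by (simp add: i_def k)
  have "(i + 1) * (i + 3) > 0" "k\<^sup>2 + ((i + 1) * (i + 3))\<^sup>2 = (j\<^sup>2 + 1)\<^sup>2"
    by (auto simp: k \<open>j = i + 2\<close> power2_eq_square algebra_simps)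
  then show ?thesis by (rule that)
next
  case False
  then obtain j where k: "k = 2 * j + 1" by (rule oddE)
  have "2 * j * (j + 1) > 0" "k\<^sup>2 + (2 * j * (j + 1))\<^sup>2 = (2 * j * (j + 1) + 1)\<^sup>2"
    using assms by (auto simp: k power2_eq_square algebra_simps)
  then show ?thesis by (rule that)
qed

lemma real2_eq_iff: "x = y \<longleftrightarrow> x $ 1 = y $ 1 \<and> x $ 2 = y $ 2" for x y :: "real^2"
  by (simp add: vec_eq_iff forall_2)

text \<open>Both coordinates are interpolated with the same parameter, so the constant one stays
  fixed and the other runs through a real interval. Sides of an axis-parallel rectangle thereby
  become coordinate inequalities.\<close>

lemma closed_segment_horizontal:
  fixes x y :: "real^2"
  assumes "x $ 2 = y $ 2"
  shows "closed_segment x y = {z. z $ 1 \<in> closed_segment (x $ 1) (y $ 1) \<and> z $ 2 = x $ 2}"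
  using assms by (auto simp: in_segment real2_eq_iff algebra_simps)

lemma closed_segment_vertical:
  fixes x y :: "real^2"
  assumes "x $ 1 = y $ 1"
  shows "closed_segment x y = {z. z $ 2 \<in> closed_segment (x $ 2) (y $ 2) \<and> z $ 1 = x $ 1}"
  using assms by (auto simp: in_segment real2_eq_iff algebra_simps)

lemma dist_real2: "dist x y = sqrt ((x $ 1 - y $ 1)\<^sup>2 + (x $ 2 - y $ 2)\<^sup>2)" for x y :: "real^2"
  by (simp add: dist_vec_def L2_set_def sum_2 dist_real_def)

lemma inner_real2: "inner x y = x $ 1 * y $ 1 + x $ 2 * y $ 2" for x y :: "real^2"
  by (simp add: inner_vec_def sum_2)

text \<open>Collinearity is equality in the Cauchy-Schwarz inequality for the two vectors issuing
  from \<open>b\<close>; orthogonality would then make a product of two nonzero norms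
  vanish.\<close>

lemma not_collinear_orthogonal:
  assumes "orthogonal (a - b) (c - b)" "a \<noteq> b" "c \<noteq> b"
  shows "\<not> collinear {a, b, c}"
proof
  assume "collinear {a, b, c}"
  then have "collinear {0, a - b, c - b}"
    by (simp add: collinear_3)
  then have "\<bar>(a - b) \<bullet> (c - b)\<bar> = norm (a - b) * norm (c - b)"
    by (simp add: norm_cauchy_schwarz_equal)
  with assms show False by (simp add: orthogonal_def)
qed

text \<open>The list starts at the origin with the horizontal side, so side 0 is the one of length
  \<open>a\<close> when \<open>a\<close> is positive.\<close>

definition axis_rectangle :: "real \<Rightarrow> real \<Rightarrow> (real^2) list" where
  "axis_rectangle a b = [vector [0, 0], vector [a, 0], vector [a, b], vector [0, b]]"

lemma nxt_4:
  assumes "length P = 4"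
  shows "nxt P 0 = 1" "nxt P (Suc 0) = 2" "nxt P 2 = 3" "nxt P 3 = 0"
  using assms by (auto simp: nxt_def)

lemma all_less_4: "(\<forall>i < 4. Q i) \<longleftrightarrow> Q 0 \<and> Q 1 \<and> Q 2 \<and> Q (3::nat)"
  by (auto simp: less_Suc_eq numeral_eq_Suc)

lemma rectangle_axis_rectangle:
  assumes "a > 0" "b > 0"
  shows "rectangle (axis_rectangle a b)"
proof -
  let ?P = "axis_rectangle a b"
  have len: "length ?P = 4" by (simp add: axis_rectangle_def)
  have nth: "?P ! 0 = vector [0, 0]" "?P ! Suc 0 = vector [a, 0]"
      "?P ! 2 = vector [a, b]" "?P ! 3 = vector [0, b]"
    by (simp_all add: axis_rectangle_def)
  have dist: "distinct ?P"
    using assms by (simp add: axis_rectangle_def real2_eq_iff)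
  have sides: "side ?P 0 = {z. 0 \<le> z $ 1 \<and> z $ 1 \<le> a \<and> z $ 2 = 0}"
      "side ?P (Suc 0) = {z. 0 \<le> z $ 2 \<and> z $ 2 \<le> b \<and> z $ 1 = a}"
      "side ?P 2 = {z. 0 \<le> z $ 1 \<and> z $ 1 \<le> a \<and> z $ 2 = b}"
      "side ?P 3 = {z. 0 \<le> z $ 2 \<and> z $ 2 \<le> b \<and> z $ 1 = 0}"
    using assms
    by (auto simp: side_def nxt_4[OF len] nth closed_segment_horizontal closed_segment_vertical
        closed_segment_eq_real_ivl)
  have ends: "side_ends ?P 0 = {vector [0, 0], vector [a, 0]}"
      "side_ends ?P (Suc 0) = {vector [a, 0], vector [a, b]}"
      "side_ends ?P 2 = {vector [a, b], vector [0, b]}"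
      "side_ends ?P 3 = {vector [0, b], vector [0, 0]}"
    by (simp_all add: side_ends_def nxt_4[OF len] nth)
  \<comment> \<open>With the sides as coordinate inequalities this is a finite check: opposite sides
    lie on distinct parallel lines because \<open>a\<close> and \<open>b\<close> are nonzero, and
    adjacent sides lie on perpendicular lines that cross at the shared corner.\<close>
  have simple: "\<forall>i < 4. \<forall>j < 4. i \<noteq> j \<longrightarrow>
      side ?P i \<inter> side ?P j = side_ends ?P i \<inter> side_ends ?P j"
    unfolding all_less_4 using assms
    by (simp add: sides ends) (auto simp: real2_eq_iff)
  have orth: "\<forall>i < 4. orthogonal (?P ! i - ?P ! nxt ?P i)
      (?P ! nxt ?P (nxt ?P i) - ?P ! nxt ?P i)"
    unfolding all_less_4 by (simp add: nxt_4[OF len] nth orthogonal_def inner_real2)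
  \<comment> \<open>A right angle excludes a straight one only if both of its arms are
    nondegenerate.\<close>
  have ne: "\<forall>i < 4. ?P ! i \<noteq> ?P ! nxt ?P i \<and> ?P ! nxt ?P (nxt ?P i) \<noteq> ?P ! nxt ?P i"
    unfolding all_less_4 using assms by (simp add: nxt_4[OF len] nth real2_eq_iff)
  have "\<forall>i < 4. \<not> collinear {?P ! i, ?P ! nxt ?P i, ?P ! nxt ?P (nxt ?P i)}"
    using orth ne not_collinear_orthogonal by blast
  then show ?thesis
    using simple orth dist by (simp add: rectangle_def polygon_def len)
qed

lemma bidiophantine_axis_rectangle:
  fixes k m h :: nat
  assumes "k > 0" "m > 0" "k\<^sup>2 + m\<^sup>2 = h\<^sup>2"
  shows "bidiophantine (axis_rectangle (real k) (real m))"
proof -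
  have diag: "(real k)\<^sup>2 + (real m)\<^sup>2 = (real h)\<^sup>2"
    using assms(3) by (metis of_nat_add of_nat_power)
  \<comment> \<open>The diagonal must also have positive length, as \<open>diophantine\<close> asks
    for positive integers.\<close>
  have "h > 0" using assms by (cases "h = 0") auto
  have "\<exists>n::nat. 0 < n \<and> dist A B = real n"
    if "A \<in> set (axis_rectangle (real k) (real m))" "B \<in> set (axis_rectangle (real k) (real m))"
       "A \<noteq> B" for A B
  proof -
    \<comment> \<open>Two distinct corners span either a side or a diagonal, and both diagonals have
      length \<open>h\<close> by \<open>diag\<close>.\<close>
    have "dist A B \<in> {real k, real m, real h}"
      using that by (auto simp: axis_rectangle_def dist_real2 diag)
    then show ?thesis using assms \<open>h > 0\<close> by blast
  qed
  moreover have "A $ c \<in> \<int>" if "A \<in> set (axis_rectangle (real k) (real m))" for A c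
    using that exhaust_2[of c] by (auto simp: axis_rectangle_def)
  ultimately show ?thesis
    using rectangle_axis_rectangle[of "real k" "real m"] assms
    by (auto simp: bidiophantine_def diophantine_def rectangle_def)
qed

theorem mainTheorem5:
  fixes k :: nat
  assumes "k > 2"
  shows "\<exists>P. rectangle P \<and> bidiophantine P \<and> (\<exists>i < length P. side_length P i = real k)"
proof -
  obtain m h :: nat where m: "m > 0" "k\<^sup>2 + m\<^sup>2 = h\<^sup>2"
    using pythagorean_leg_exists[OF assms] .
  let ?P = "axis_rectangle (real k) (real m)"
  \<comment> \<open>Index 0 is the witness: this side runs from the origin to (k, 0).\<close>
  have "side_length ?P 0 = real k" "0 < length ?P"
    by (simp_all add: side_length_def nxt_def axis_rectangle_def dist_real2)
  moreover have "rectangle ?P" "bidiophantine ?P"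
    using rectangle_axis_rectangle bidiophantine_axis_rectangle assms m by simp_all
  ultimately show ?thesis by blast
qed

end
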